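(* Let $\mathbb{F}_q$ be a finite field and let $\mathcal{C}\subset\mathbb{F}_q[z]^n$ be a self-dual convolutional code with generator matrix $G(z)$. Let $r\in\mathbb{N}$ and for $i=1,\dots,r$ let $M_i(z)\in\mathbb{F}_q[z]^{n\times n}$ be such that $M_i(z)M_i(z)^\top=\lambda_i I_n$ with $\lambda_i$ invertible in $\mathbb{F}_q[z]$. Let $A_1,\dots,A_r$ be $n\times n$ permutation matrices. Then $$G_r(z)=G(z)M_1(z)A_1\cdots M_r(z)A_r$$ generates a self-dual convolutional code.
   Context: An $(n,k)$ convolutional code over $\mathbb{F}_q$ is an $\mathbb{F}_q[z]$-submodule $\mathcal{C}\subset\mathbb{F}_q[z]^n$ of rank $k$. A generator matrix of $\mathcal{C}$ is a matrix $G(z)\in\mathbb{F}_q[z]^{k\times n}$ whose rows form a basis of $\mathcal{C}$; one says $G(z)$ generates $\mathcal{C}$. The dual is $\mathcal{C}^\perp=\{f(z)\in\mathbb{F}_q[z]^n : f(z)c(z)^\top=0\ \forall c(z)\in\mathcal{C}\}$, and $\mathcal{C}$ is self-dual if $\mathcal{C}=\mathcal{C}^\perp$. $I_n$ is the $n\times n$ identity matrix. *)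

theory Defs
  imports
    "Jordan_Normal_Form.VS_Connect"
    "HOL-Combinatorics.Permutations"
begin

text \<open>
  Row vectors of \<open>F\<^sub>q[z]\<^sup>n\<close> are elements of \<^term>\<open>carrier_vec n\<close> over the type
  \<^typ>\<open>'a poly\<close>, where \<^typ>\<open>'a\<close> is a finite field.
\<close>

definition module_basis :: "nat \<Rightarrow> 'a::{finite,field} poly vec set \<Rightarrow> 'a poly vec set \<Rightarrow> bool"
  where "module_basis n C B \<longleftrightarrow>
    B \<subseteq> carrier_vec n \<and>
    \<not> LinearCombinations.module.lin_dep class_ring (module_vec TYPE('a poly) n) B \<and>
    LinearCombinations.module.span class_ring (module_vec TYPE('a poly) n) B = C"

text \<open>
  Since \<open>F\<^sub>q[z]\<close> is a principal ideal domain, every submodule of \<open>F\<^sub>q[z]\<^sup>n\<close> is free, and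
  its rank is the cardinality of any of its bases.
\<close>

definition convolutional_code :: "nat \<Rightarrow> nat \<Rightarrow> 'a::{finite,field} poly vec set \<Rightarrow> bool"
  where "convolutional_code n k C \<longleftrightarrow>
    submodule class_ring C (module_vec TYPE('a poly) n) \<and>
    (\<exists>B. finite B \<and> card B = k \<and> module_basis n C B)"

text \<open>
  Distinctness is required because \<^const>\<open>module_basis\<close> only sees the set of rows, so a
  repeated row would otherwise go unnoticed.
\<close>

definition generator_matrix ::
  "nat \<Rightarrow> nat \<Rightarrow> 'a::{finite,field} poly vec set \<Rightarrow> 'a poly mat \<Rightarrow> bool"
  where "generator_matrix n k C G \<longleftrightarrow>
    G \<in> carrier_mat k n \<and> distinct (rows G) \<and> module_basis n C (set (rows G))"

definition dual_code :: "nat \<Rightarrow> 'a::{finite,field} poly vec set \<Rightarrow> 'a poly vec set"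
  where "dual_code n C = {f \<in> carrier_vec n. \<forall>c\<in>C. f \<bullet> c = 0}"

definition self_dual :: "nat \<Rightarrow> 'a::{finite,field} poly vec set \<Rightarrow> bool"
  where "self_dual n C \<longleftrightarrow> C = dual_code n C"

definition permutation_matrix :: "nat \<Rightarrow> 'a::{zero,one} mat \<Rightarrow> bool"
  where "permutation_matrix n A \<longleftrightarrow>
    (\<exists>p. p permutes {..<n} \<and> A = mat n n (\<lambda>(i, j). if j = p i then 1 else 0))"

end

theory Submission
  imports Defs
begin

text \<open>
  Right multiplication by \<open>N\<close> with \<open>N N\<^sup>T = \<lambda> I\<close>, \<open>\<lambda>\<close> a unit, is an automorphism of
  \<open>F\<^sub>q[z]\<^sup>n\<close>, so it carries bases to bases. It multiplies the bilinear form by \<open>\<lambda>\<close>, so it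
  also commutes with taking duals. Each factor \<open>M\<^sub>i A\<^sub>i\<close> is such an \<open>N\<close>, because
  \<open>A\<^sub>i A\<^sub>i\<^sup>T = I\<close>.
\<close>

section \<open>Square matrices over a commutative ring\<close>

text \<open>Polynomial entries rule out dividing by pivots, so the argument goes through
  determinants: \<open>A * B = 1\<close> makes \<open>det A\<close> a unit, the rescaled adjugate is
  then a left inverse of \<open>A\<close>, and a left inverse must agree with the right inverse
  \<open>B\<close>.\<close>

lemma mat_mult_left_right_inverse_comm_ring:
  fixes A B :: "'a::comm_ring_1 mat"
  assumes A: "A \<in> carrier_mat n n" and B: "B \<in> carrier_mat n n" and AB: "A * B = 1\<^sub>m n"
  shows "B * A = 1\<^sub>m n"
proof -
  \<comment> \<open>The factor \<open>det B\<close> plays the role of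
    \<open>1 / det A\<close>.\<close>
  define L where "L = det B \<cdot>\<^sub>m adj_mat A"
  have L: "L \<in> carrier_mat n n"
    using adj_mat(1)[OF A] by (simp add: L_def)
  have "det A * det B = 1"
    using det_mult[OF A B] AB by simp
  hence LA: "L * A = 1\<^sub>m n"
    using adj_mat[OF A] A
    by (intro eq_matI) (auto simp: L_def mult_smult_assoc_mat[OF _ A] mult.commute)
  have "L = L * (A * B)"
    using L AB by simp
  also have "\<dots> = B"
    using L A B LA by (simp flip: assoc_mult_mat)
  finally show ?thesis
    using LA by simp
qed

text \<open>Row \<open>i\<close> of \<open>A\<close> is the unit vector at position
  \<open>p i\<close>; since \<open>p\<close> is injective, distinct rows are distinct unit vectors,
  hence orthonormal.\<close>

lemma permutation_matrix_mult_transpose: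
  fixes A :: "'a::comm_ring_1 mat"
  assumes "permutation_matrix n A"
  shows "A \<in> carrier_mat n n" and "A * transpose_mat A = 1\<^sub>m n"
proof -
  obtain p where p: "p permutes {..<n}"
    and A: "A = mat n n (\<lambda>(i, j). if j = p i then 1 else 0)"
    using assms unfolding permutation_matrix_def by blast
  show "A \<in> carrier_mat n n"
    by (simp add: A)
  show "A * transpose_mat A = 1\<^sub>m n"
  proof (rule eq_matI)
    fix i j assume "i < dim_row (1\<^sub>m n :: 'a mat)" and "j < dim_col (1\<^sub>m n :: 'a mat)"
    hence ij: "i < n" "j < n" by simp_all
    have "p i < n"
      using permutes_in_image[OF p] ij by simp
    have "(A * transpose_mat A) $$ (i, j)
        = (\<Sum>k\<in>{0..<n}. (if k = p i then 1 else 0) * (if k = p j then 1 else 0))"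
      using ij by (simp add: A scalar_prod_def)
    \<comment> \<open>Only the index \<open>k = p i\<close> can contribute, and it lies in the range
      of summation.\<close>
    also have "\<dots> = (\<Sum>k\<in>{0..<n}. if k = p i then (if p i = p j then 1 else 0) else 0)"
      by (rule sum.cong) auto
    also have "\<dots> = (if p i = p j then 1 else 0)"
      using \<open>p i < n\<close> by simp
    also have "\<dots> = 1\<^sub>m n $$ (i, j)"
      using ij permutes_inj[OF p] by (simp add: inj_eq)
    finally show "(A * transpose_mat A) $$ (i, j) = 1\<^sub>m n $$ (i, j)" .
  qed (simp_all add: A)
qed

section \<open>Linear combinations, independence and span under a matrix\<close>

lemma mult_mat_vec_zero:
  fixes A :: "'a::semiring_0 mat"
  assumes "A \<in> carrier_mat m n"
  shows "A *\<^sub>v 0\<^sub>v n = 0\<^sub>v m"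
  using assms by (intro eq_vecI) (auto simp: scalar_prod_def)

lemma smult_mult_mat_vec:
  fixes A :: "'a::comm_semiring_0 mat"
  assumes "A \<in> carrier_mat m n" and "v \<in> carrier_vec n"
  shows "(a \<cdot>\<^sub>m A) *\<^sub>v v = a \<cdot>\<^sub>v (A *\<^sub>v v)"
  using assms by (intro eq_vecI) (auto simp: scalar_prod_def sum_distrib_left mult.assoc)

lemma mult_mat_vec_smult:
  fixes A :: "'a::comm_semiring_0 mat"
  assumes "A \<in> carrier_mat m n" and "v \<in> carrier_vec n"
  shows "A *\<^sub>v (a \<cdot>\<^sub>v v) = a \<cdot>\<^sub>v (A *\<^sub>v v)"
  using assms by (intro eq_vecI) (auto simp: scalar_prod_def sum_distrib_left mult.left_commute)

context vec_module
begin

text \<open>Coefficients are indexed by the vectors themselves, so those on the image are pulled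
  back along \<open>P\<close>. Injectivity keeps two vectors of \<open>A\<close> from merging into
  one summand.\<close>

lemma lincomb_image_mult_mat_vec:
  assumes P: "P \<in> carrier_mat n n" and "finite A" and "A \<subseteq> carrier_vec n"
    and "inj_on ((*\<^sub>v) P) A"
  shows "lincomb b ((*\<^sub>v) P ` A) = P *\<^sub>v lincomb (\<lambda>v. b (P *\<^sub>v v)) A"
  using assms(2-)
proof (induction A rule: finite_induct)
  case empty
  show ?case
    using P by (simp add: lincomb_def mult_mat_vec_zero)
next
  case (insert v A)
  have v: "v \<in> carrier_vec n" and A: "A \<subseteq> carrier_vec n" and inj: "inj_on ((*\<^sub>v) P) A"
    using insert.prems by auto
  have PvA: "P *\<^sub>v v \<notin> (*\<^sub>v) P ` A"
    using insert.prems insert.hyps by (auto simp: inj_on_def)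
  have PA: "(*\<^sub>v) P ` A \<subseteq> carrier_vec n"
    using P A by auto
  have "lincomb b ((*\<^sub>v) P ` insert v A)
      = b (P *\<^sub>v v) \<cdot>\<^sub>v (P *\<^sub>v v) + lincomb b ((*\<^sub>v) P ` A)"
    using lincomb_insert2[OF _ PA TrueI PvA, of b] insert.hyps P v by simp
  also have "\<dots> = P *\<^sub>v (b (P *\<^sub>v v) \<cdot>\<^sub>v v + lincomb (\<lambda>v. b (P *\<^sub>v v)) A)"
    using insert.IH[OF A inj] P v lincomb_closed[OF A]
    by (simp add: mult_add_distrib_mat_vec[of _ n n] mult_mat_vec_smult[OF P v])
  also have "\<dots> = P *\<^sub>v lincomb (\<lambda>v. b (P *\<^sub>v v)) (insert v A)"
    using lincomb_insert2[OF insert.hyps(1) A TrueI insert.hyps(2) v] by simp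
  finally show ?case .
qed

context
  fixes P Q :: "'a mat"
  assumes P: "P \<in> carrier_mat n n" and Q: "Q \<in> carrier_mat n n" and QP: "Q * P = 1\<^sub>m n"
begin

lemma left_inverse_mult_mat_vec:
  assumes "v \<in> carrier_vec n"
  shows "Q *\<^sub>v (P *\<^sub>v v) = v"
  using assms assoc_mult_mat_vec[OF Q P assms] QP by simp

lemma inj_on_mult_mat_vec: "A \<subseteq> carrier_vec n \<Longrightarrow> inj_on ((*\<^sub>v) P) A"
  by (rule inj_on_inverseI[of _ "(*\<^sub>v) Q"]) (auto simp: left_inverse_mult_mat_vec)

text \<open>A dependence among the images is \<open>P\<close> applied to a combination of the
  original vectors; applying \<open>Q\<close> turns it into a dependence in
  \<open>B\<close>.\<close>

lemma lin_indpt_image_mult_mat_vec: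
  assumes B: "B \<subseteq> carrier_vec n" and indpt: "lin_indpt B"
  shows "lin_indpt ((*\<^sub>v) P ` B)"
proof
  assume "lin_dep ((*\<^sub>v) P ` B)"
  then obtain A' b v where A': "finite A'" "A' \<subseteq> (*\<^sub>v) P ` B" "lincomb b A' = 0\<^sub>v n"
    "v \<in> A'" "b v \<noteq> 0"
    unfolding lin_dep_def by auto
  obtain A where A: "A \<subseteq> B" "finite A" "A' = (*\<^sub>v) P ` A"
    using finite_subset_image[OF A'(1,2)] by blast
  have AC: "A \<subseteq> carrier_vec n"
    using A B by blast
  have "P *\<^sub>v lincomb (\<lambda>v. b (P *\<^sub>v v)) A = 0\<^sub>v n"
    using lincomb_image_mult_mat_vec[OF P A(2) AC inj_on_mult_mat_vec[OF AC]] A A' by simp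
  hence "lincomb (\<lambda>v. b (P *\<^sub>v v)) A = Q *\<^sub>v 0\<^sub>v n"
    using left_inverse_mult_mat_vec[OF lincomb_closed[OF AC], of "\<lambda>v. b (P *\<^sub>v v)"] by simp
  hence "lincomb (\<lambda>v. b (P *\<^sub>v v)) A = 0\<^sub>v n"
    using Q by (simp add: mult_mat_vec_zero)
  \<comment> \<open>The preimage \<open>u\<close> of \<open>v\<close> inherits the nonzero
    coefficient \<open>b v\<close>, so the pulled-back dependence is nontrivial.\<close>
  moreover obtain u where "u \<in> A" "v = P *\<^sub>v u"
    using A A' by auto
  ultimately have "lin_dep B"
    using lin_dep_crit[of A B u "\<lambda>v. b (P *\<^sub>v v)"] A A' by simp
  thus False
    using indpt by simp
qed

lemma span_image_mult_mat_vec: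
  assumes B: "B \<subseteq> carrier_vec n"
  shows "span ((*\<^sub>v) P ` B) = (*\<^sub>v) P ` span B"
proof
  show "span ((*\<^sub>v) P ` B) \<subseteq> (*\<^sub>v) P ` span B"
  proof
    fix w assume "w \<in> span ((*\<^sub>v) P ` B)"
    then obtain b A' where A': "finite A'" "A' \<subseteq> (*\<^sub>v) P ` B" "w = lincomb b A'"
      unfolding span_def by auto
    obtain A where A: "A \<subseteq> B" "finite A" "A' = (*\<^sub>v) P ` A"
      using finite_subset_image[OF A'(1,2)] by blast
    have AC: "A \<subseteq> carrier_vec n"
      using A B by blast
    have "w = P *\<^sub>v lincomb (\<lambda>v. b (P *\<^sub>v v)) A"
      using lincomb_image_mult_mat_vec[OF P A(2) AC inj_on_mult_mat_vec[OF AC]] A A' by simp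
    thus "w \<in> (*\<^sub>v) P ` span B"
      using A unfolding span_def by auto
  qed
  show "(*\<^sub>v) P ` span B \<subseteq> span ((*\<^sub>v) P ` B)"
  proof
    fix w assume "w \<in> (*\<^sub>v) P ` span B"
    then obtain a A where A: "finite A" "A \<subseteq> B" "w = P *\<^sub>v lincomb a A"
      unfolding span_def by auto
    have AC: "A \<subseteq> carrier_vec n"
      using A B by blast
    \<comment> \<open>Coefficients for the image are obtained by composing \<open>a\<close> with
      \<open>Q\<close>; pulling them back along \<open>P\<close> restores \<open>a\<close> on
      \<open>A\<close>.\<close>
    have "lincomb (\<lambda>v. a (Q *\<^sub>v (P *\<^sub>v v))) A = lincomb a A"
      using AC left_inverse_mult_mat_vec by (intro lincomb_cong) auto
    hence "w = lincomb (\<lambda>v. a (Q *\<^sub>v v)) ((*\<^sub>v) P ` A)"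
      using lincomb_image_mult_mat_vec[OF P A(1) AC inj_on_mult_mat_vec[OF AC]] A by simp
    thus "w \<in> span ((*\<^sub>v) P ` B)"
      using A unfolding span_def by blast
  qed
qed

end

end

section \<open>Generator matrices under right multiplication\<close>

text \<open>The transpose appears because a row vector times \<open>N\<close> is written as a matrix
  acting from the left. This makes the results on images under a matrix applicable to the
  rows.\<close>

lemma rows_mult_eq_map:
  fixes G N :: "'a::comm_semiring_0 mat"
  assumes G: "G \<in> carrier_mat k n" and N: "N \<in> carrier_mat n m"
  shows "rows (G * N) = map ((*\<^sub>v) (transpose_mat N)) (rows G)"
proof (rule nth_equalityI)
  fix i assume "i < length (rows (G * N))"
  hence i: "i < k" using G by simp
  show "rows (G * N) ! i = map ((*\<^sub>v) (transpose_mat N)) (rows G) ! i"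
  proof (rule eq_vecI)
    fix j assume "j < dim_vec (map ((*\<^sub>v) (transpose_mat N)) (rows G) ! i)"
    hence j: "j < m" using i G N by simp
    show "(rows (G * N) ! i) $ j = (map ((*\<^sub>v) (transpose_mat N)) (rows G) ! i) $ j"
      using i j G N by (simp add: comm_scalar_prod[of _ n])
  qed (use i G N in simp)
qed (use G in simp)

text \<open>The set of rows is the required basis; distinctness of the rows gives it cardinality
  exactly \<open>k\<close>.\<close>

lemma generator_matrix_imp_convolutional_code:
  assumes "generator_matrix n k C G"
  shows "convolutional_code n k C"
proof -
  interpret vec_module "TYPE('a poly)" n .
  have G: "G \<in> carrier_mat k n" "distinct (rows G)" "module_basis n C (set (rows G))"
    using assms by (auto simp: generator_matrix_def)
  have "submodule class_ring C V"
    using G(3) span_is_submodule[of "set (rows G)"] by (auto simp: module_basis_def)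
  moreover have "card (set (rows G)) = k"
    using distinct_card[OF G(2)] G(1) by simp
  ultimately show ?thesis
    using G(3) unfolding convolutional_code_def by blast
qed

text \<open>The left inverse \<open>L\<close> makes the transpose of \<open>N\<close> injective, so
  the rows stay distinct and independent, and the span is carried along.\<close>

lemma generator_matrix_mult:
  fixes N L :: "'a::{finite,field} poly mat"
  assumes gen: "generator_matrix n k C G"
    and N: "N \<in> carrier_mat n n" and L: "L \<in> carrier_mat n n"
    and inv: "L * transpose_mat N = 1\<^sub>m n"
  shows "generator_matrix n k ((*\<^sub>v) (transpose_mat N) ` C) (G * N)"
proof -
  interpret vec_module "TYPE('a poly)" n .
  have G: "G \<in> carrier_mat k n" "distinct (rows G)"
    and B: "set (rows G) \<subseteq> carrier_vec n" "lin_indpt (set (rows G))" "span (set (rows G)) = C"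
    using gen by (auto simp: generator_matrix_def module_basis_def)
  have NT: "transpose_mat N \<in> carrier_mat n n"
    using N by simp
  note * = NT L inv B(1)
  have "distinct (rows (G * N))"
    using inj_on_mult_mat_vec[OF *] G(2)
    by (simp add: rows_mult_eq_map[OF G(1) N] distinct_map)
  moreover have "module_basis n ((*\<^sub>v) (transpose_mat N) ` C) (set (rows (G * N)))"
    using lin_indpt_image_mult_mat_vec[OF * B(2)] span_image_mult_mat_vec[OF *] B NT
    by (auto simp: module_basis_def rows_mult_eq_map[OF G(1) N])
  ultimately show ?thesis
    using G(1) N by (simp add: generator_matrix_def)
qed

section \<open>Self-duality under right multiplication\<close>

text \<open>Both the image and its dual turn out to be the set of \<open>f\<close> with
  \<open>N *\<^sub>v f \<in> C\<close>: the dual by moving the transpose across the bilinear form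
  and using that \<open>C\<close> is its own dual, the image by the two identities for
  \<open>N\<close>.\<close>

lemma self_dual_image:
  fixes N :: "'a::{finite,field} poly mat"
  assumes sd: "self_dual n C"
    and N: "N \<in> carrier_mat n n"
    and NNT: "N * transpose_mat N = l \<cdot>\<^sub>m 1\<^sub>m n"
    and NTN: "transpose_mat N * (l' \<cdot>\<^sub>m N) = 1\<^sub>m n"
  shows "self_dual n ((*\<^sub>v) (transpose_mat N) ` C)"
proof -
  have C: "C = dual_code n C"
    using sd by (simp add: self_dual_def)
  have NT: "transpose_mat N \<in> carrier_mat n n"
    using N by simp
  have CV: "c \<in> carrier_vec n" if "c \<in> C" for c
    using that by (subst (asm) C) (simp add: dual_code_def)
  \<comment> \<open>Closure under scalars is read off from \<open>C\<close> being its own dual,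
    since orthogonality survives scaling.\<close>
  have smult: "a \<cdot>\<^sub>v c \<in> C" if "c \<in> C" for a c
  proof -
    have "c \<in> dual_code n C"
      using that C by blast
    hence "a \<cdot>\<^sub>v c \<in> dual_code n C"
      using CV by (auto simp: dual_code_def)
    thus ?thesis
      using C by blast
  qed
  have adjoint: "f \<bullet> (transpose_mat N *\<^sub>v c) = (N *\<^sub>v f) \<bullet> c"
    if "f \<in> carrier_vec n" "c \<in> C" for f c
    using transpose_vec_mult_scalar[OF N that(1) CV[OF that(2)]] CV[OF that(2)] N NT that
    by (metis comm_scalar_prod mult_mat_vec_carrier)
  have dual: "f \<in> dual_code n ((*\<^sub>v) (transpose_mat N) ` C)
      \<longleftrightarrow> f \<in> carrier_vec n \<and> N *\<^sub>v f \<in> C" for f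
  proof -
    have "f \<in> dual_code n ((*\<^sub>v) (transpose_mat N) ` C)
        \<longleftrightarrow> f \<in> carrier_vec n \<and> N *\<^sub>v f \<in> dual_code n C"
      using N by (auto simp: dual_code_def adjoint)
    thus ?thesis
      using C by blast
  qed
  have "f \<in> (*\<^sub>v) (transpose_mat N) ` C \<longleftrightarrow> f \<in> carrier_vec n \<and> N *\<^sub>v f \<in> C" for f
  proof
    assume "f \<in> (*\<^sub>v) (transpose_mat N) ` C"
    then obtain c where c: "c \<in> C" "f = transpose_mat N *\<^sub>v c" by blast
    have "N *\<^sub>v f = l \<cdot>\<^sub>v c"
      using assoc_mult_mat_vec[OF N NT CV[OF c(1)]] NNT CV[OF c(1)] c(2)
      by (simp add: smult_mult_mat_vec[of _ n n])
    thus "f \<in> carrier_vec n \<and> N *\<^sub>v f \<in> C"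
      using smult c NT CV by auto
  next
    assume f: "f \<in> carrier_vec n \<and> N *\<^sub>v f \<in> C"
    \<comment> \<open>The witness in \<open>C\<close> is \<open>N *\<^sub>v f\<close> scaled by
      \<open>l'\<close>; \<open>NTN\<close> sends it back to \<open>f\<close>.\<close>
    have "f = transpose_mat N *\<^sub>v (l' \<cdot>\<^sub>v (N *\<^sub>v f))"
      using f assoc_mult_mat_vec[OF NT _, of "l' \<cdot>\<^sub>m N" n f] NTN N
      by (simp add: smult_mult_mat_vec[of _ n n])
    thus "f \<in> (*\<^sub>v) (transpose_mat N) ` C"
      using smult f by blast
  qed
  thus ?thesis
    using dual unfolding self_dual_def by blast
qed

lemma self_dual_generator_mult:
  fixes N :: "'a::{finite,field} poly mat"
  assumes sd: "self_dual n C" and gen: "generator_matrix n k C G"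
    and N: "N \<in> carrier_mat n n"
    and NNT: "N * transpose_mat N = l \<cdot>\<^sub>m 1\<^sub>m n" and unit: "l dvd 1"
  shows "\<exists>C'. self_dual n C' \<and> generator_matrix n k C' (G * N)"
proof -
  obtain l' where l': "l * l' = 1"
    using unit by (metis dvdE)
  have L: "l' \<cdot>\<^sub>m N \<in> carrier_mat n n"
    using N by simp
  have NT: "transpose_mat N \<in> carrier_mat n n"
    using N by simp
  have inv: "(l' \<cdot>\<^sub>m N) * transpose_mat N = 1\<^sub>m n"
    using l' by (intro eq_matI) (auto simp: mult_smult_assoc_mat[OF N NT] NNT mult.commute)
  \<comment> \<open>\<open>inv\<close> gives a left inverse of the transpose, as needed for the
    basis; self-duality needs the same matrix as a right inverse, hence the swap of factors.\<close>
  show ?thesis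
    using generator_matrix_mult[OF gen N L inv]
      self_dual_image[OF sd N NNT mat_mult_left_right_inverse_comm_ring[OF L NT inv]]
    by blast
qed

section \<open>Products of several factors\<close>

lemma mult_orthogonal_mult_transpose:
  fixes M A :: "'a::comm_ring_1 mat"
  assumes M: "M \<in> carrier_mat n n" and A: "A \<in> carrier_mat n n"
    and AAT: "A * transpose_mat A = 1\<^sub>m n"
  shows "(M * A) * transpose_mat (M * A) = M * transpose_mat M"
proof -
  have "(M * A) * transpose_mat (M * A) = M * (A * (transpose_mat A * transpose_mat M))"
    using M A assoc_mult_mat[OF M A, of "transpose_mat A * transpose_mat M" n]
    by (simp add: transpose_mult[OF M A])
  also have "\<dots> = M * ((A * transpose_mat A) * transpose_mat M)"
    using M A by (subst assoc_mult_mat[of A n n "transpose_mat A" n]) auto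
  finally show ?thesis
    using M AAT by simp
qed

theorem proposition2:
  fixes n k r :: nat
    and C :: "'a::{finite,field} poly vec set"
    and G :: "'a poly mat"
    and M A :: "nat \<Rightarrow> 'a poly mat"
    and lam :: "nat \<Rightarrow> 'a poly"
  assumes "convolutional_code n k C"
    and "self_dual n C"
    and "generator_matrix n k C G"
    and "\<And>i. i \<in> {1..r} \<Longrightarrow> M i \<in> carrier_mat n n"
    and "\<And>i. i \<in> {1..r} \<Longrightarrow> M i * transpose_mat (M i) = lam i \<cdot>\<^sub>m 1\<^sub>m n"
    and "\<And>i. i \<in> {1..r} \<Longrightarrow> lam i dvd 1"
    and "\<And>i. i \<in> {1..r} \<Longrightarrow> permutation_matrix n (A i)"
  shows "\<exists>C'. convolutional_code n k C' \<and> self_dual n C' \<and>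
    generator_matrix n k C' (foldl (\<lambda>X i. X * M i * A i) G [1..<Suc r])"
proof -
  \<comment> \<open>The induction carries only self-duality and the generator matrix; being a code
    of rank \<open>k\<close> follows from the latter at the end.\<close>
  have "\<exists>C'. self_dual n C' \<and>
      generator_matrix n k C' (foldl (\<lambda>X i. X * M i * A i) G [1..<Suc r])"
    using assms(4-7)
  proof (induction r)
    case 0
    show ?case
      using assms(2,3) by auto
  next
    case (Suc r)
    define X where "X = foldl (\<lambda>X i. X * M i * A i) G [1..<Suc r]"
    have "\<exists>C'. self_dual n C' \<and> generator_matrix n k C' X"
      unfolding X_def by (rule Suc.IH; rule Suc.prems; simp)
    then obtain C' where C': "self_dual n C'" "generator_matrix n k C' X"
      by blast
    have M: "M (Suc r) \<in> carrier_mat n n"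
      and MMT: "M (Suc r) * transpose_mat (M (Suc r)) = lam (Suc r) \<cdot>\<^sub>m 1\<^sub>m n"
      and unit: "lam (Suc r) dvd 1"
      and perm: "permutation_matrix n (A (Suc r))"
      using Suc.prems by simp_all
    note A = permutation_matrix_mult_transpose[OF perm]
    have X: "X \<in> carrier_mat k n"
      using C'(2) by (simp add: generator_matrix_def)
    \<comment> \<open>The fold multiplies by \<open>M (Suc r)\<close> and \<open>A (Suc r)\<close>
      in turn; associativity groups them into the single factor to which the one-factor result
      applies.\<close>
    have step: "foldl (\<lambda>X i. X * M i * A i) G [1..<Suc (Suc r)] = X * (M (Suc r) * A (Suc r))"
      using assoc_mult_mat[OF X M A(1)] by (simp add: X_def)
    have MA: "(M (Suc r) * A (Suc r)) * transpose_mat (M (Suc r) * A (Suc r))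
        = lam (Suc r) \<cdot>\<^sub>m 1\<^sub>m n"
      using mult_orthogonal_mult_transpose[OF M A] MMT by simp
    show ?case
      unfolding step
      by (rule self_dual_generator_mult[OF C' mult_carrier_mat[OF M A(1)] MA unit])
  qed
  thus ?thesis
    using generator_matrix_imp_convolutional_code by blast
qed

end
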